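(* For complex $a,b,x$, $$\sum_{n=0}^{\infty}\Bigl(\frac{xe^{-bx^2}}{x+1}\Bigr)^n\,{}_2F_2\Bigl(\tfrac12-\tfrac n2,-\tfrac n2;\,\tfrac12,1;\,a+bn\Bigr)=-\frac{(x+1)e^{ax^2}}{2bx^3+2bx^2-1}.$$
   Context: ${}_2F_2(a_1,a_2;b_1,b_2;z)=\sum_{k\ge0}\frac{(a_1)_k(a_2)_k}{(b_1)_k(b_2)_k\,k!}z^k$ is the generalized hypergeometric function, with $(a)_k=a(a+1)\cdots(a+k-1)$.
   Formalization: The identity fails for some complex x (a=0, b=1, x=3: sum ≈ 1.0001, right side −4/71), so x is restricted to the connected component of 0 in the set where x ≠ −1 and |xe^{−bx²}/(x+1)| is less than the radius of convergence of the series. *)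

theory Defs
  imports "HOL-Analysis.Analysis"
begin

definition hyp2F2 :: "complex \<Rightarrow> complex \<Rightarrow> complex \<Rightarrow> complex \<Rightarrow> complex \<Rightarrow> complex" where
  "hyp2F2 a1 a2 b1 b2 z =
     (\<Sum>k. (pochhammer a1 k * pochhammer a2 k) /
           (pochhammer b1 k * pochhammer b2 k * fact k) * z ^ k)"

definition gf_coeff :: "complex \<Rightarrow> complex \<Rightarrow> nat \<Rightarrow> complex" where
  "gf_coeff a b n =
     hyp2F2 (1/2 - of_nat n / 2) (- (of_nat n / 2)) (1/2) 1 (a + b * of_nat n)"

definition gf_arg :: "complex \<Rightarrow> complex \<Rightarrow> complex" where
  "gf_arg b x = x * exp (- b * x\<^sup>2) / (x + 1)"

(* The left-hand side is a power series in gf_arg b x.  For b \<noteq> 0 the map gf_arg b is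
   not injective, and it also takes small values far away from x = 0, where the series
   converges to the value belonging to a different x (e.g. a = 0, b = 1, x = 3).  The
   identity therefore concerns the component, containing x = 0, of the region where the
   power series converges.  The condition x \<noteq> -1 is needed because x / 0 = 0 in HOL.
   If 0 were not in the region, gf_domain would be empty. *)
definition gf_domain :: "complex \<Rightarrow> complex \<Rightarrow> complex set" where
  "gf_domain a b =
     connected_component_set
       {x. x \<noteq> -1 \<and> ereal (norm (gf_arg b x)) < conv_radius (gf_coeff a b)} 0"

end

theory Submission
  imports Defs "HOL-Complex_Analysis.Complex_Analysis"
begin

text \<open>
  Since \<open>(1/2 - n/2)\<^sub>k (- n/2)\<^sub>k / ((1/2)\<^sub>k k!) = (n choose 2k)\<close>, the \<open>n\<close>-th coefficient is the
  coefficient of \<open>t\<^sup>n\<close> in \<open>f(t) \<phi>(t)\<^sup>n\<close> with \<open>f(t) = exp (a t\<^sup>2)\<close> and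
  \<open>\<phi>(t) = (1 + t) exp (b t\<^sup>2)\<close>. As the argument of the series is \<open>x / \<phi>(x)\<close>, Lagrange inversion
  gives the sum \<open>f(x) / (1 - x \<phi>'(x) / \<phi>(x))\<close> near \<open>x = 0\<close>, which is the claimed value.
  Both sides, multiplied by \<open>2bx\<^sup>3 + 2bx\<^sup>2 - 1\<close>, are holomorphic on the connected domain, so the
  identity extends to all of it. There \<open>x \<noteq> -1\<close>, so the right-hand side of the multiplied identity
  is nonzero, and hence so is the denominator.
\<close>

section \<open>Lagrange inversion in the form of a convergent series\<close>

text \<open>Put w = x / \<open>\<phi>\<close> x. By Cauchy's formula the partial sums are contour
  integrals of truncations of the geometric series for f(t) / (t - w \<open>\<phi>\<close>(t)). In
  the disc this integrand has at most a simple pole at t = x, with residue f(x) / (1 - w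
  \<open>\<phi>\<close>'(x)).\<close>

lemma lagrange_inversion_sums:
  fixes f \<phi> :: "complex \<Rightarrow> complex"
  assumes S: "open S" "0 \<in> S" and holf: "f holomorphic_on S" and hol\<phi>: "\<phi> holomorphic_on S"
    and \<phi>0: "\<phi> 0 \<noteq> 0"
  shows "\<forall>\<^sub>F x in nhds 0.
    (\<lambda>n. (deriv ^^ n) (\<lambda>t. f t * \<phi> t ^ n) 0 / fact n * (x / \<phi> x) ^ n)
      sums (f x / (1 - x / \<phi> x * deriv \<phi> x))"
proof -
  obtain r where r: "r > 0" "cball 0 r \<subseteq> S"
    using S open_contains_cball by blast
  have cont: "continuous_on (cball 0 r) g" if "g holomorphic_on S" for g :: "complex \<Rightarrow> complex"
    using that r(2) holomorphic_on_imp_continuous_on holomorphic_on_subset by blast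
  have bound: "\<exists>B>0. \<forall>t\<in>cball 0 r. norm (g t) \<le> B" if "g holomorphic_on S"
    for g :: "complex \<Rightarrow> complex"
    using compact_imp_bounded[OF compact_continuous_image[OF cont[OF that] compact_cball]]
    by (auto simp: bounded_pos)
  obtain A where A: "A > 0" "\<And>t. t \<in> cball 0 r \<Longrightarrow> norm (f t) \<le> A"
    using bound[OF holf] by blast
  obtain K where K: "K > 0" "\<And>t. t \<in> cball 0 r \<Longrightarrow> norm (\<phi> t) \<le> K"
    using bound[OF hol\<phi>] by blast
  obtain M where M: "M > 0" "\<And>t. t \<in> cball 0 r \<Longrightarrow> norm (deriv \<phi> t) \<le> M"
    using bound[OF holomorphic_deriv[OF hol\<phi> S(1)]] by blast
  \<comment> \<open>The disc is convex, so the bound on the derivative also bounds all difference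
    quotients of \<open>\<phi>\<close> by M.\<close>
  have lip: "norm (\<phi> t - \<phi> x) \<le> M * norm (t - x)" if "t \<in> cball 0 r" "x \<in> cball 0 r" for t x
  proof (rule field_differentiable_bound[of "cball 0 r" \<phi> "deriv \<phi>"])
    fix z :: complex assume "z \<in> cball 0 r"
    then show "(\<phi> has_field_derivative deriv \<phi> z) (at z within cball 0 r)"
      using holomorphic_derivI[OF hol\<phi> S(1)] r(2) has_field_derivative_at_within by blast
  qed (use that M in auto)
  have "continuous_on S \<phi>"
    using hol\<phi> holomorphic_on_imp_continuous_on by blast
  then have "isCont \<phi> 0"
    using S continuous_on_eq_continuous_at by blast
  then have cont\<phi>: "(\<phi> \<longlongrightarrow> \<phi> 0) (nhds 0)"
    by (simp add: continuous_at_imp_continuous_at_within isCont_def tendsto_nhds_iff)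
  have tw: "((\<lambda>x. x / \<phi> x) \<longlongrightarrow> 0) (nhds 0)"
    using tendsto_divide[OF filterlim_ident cont\<phi> \<phi>0] by simp
  have "\<forall>\<^sub>F x in nhds 0. \<phi> x \<noteq> 0"
    using cont\<phi> \<phi>0 by (rule tendsto_imp_eventually_ne)
  \<comment> \<open>The bound 1 / M keeps 1 - w \<open>\<psi>\<close>(t) away from zero on the disc;
    the bound r / K makes the geometric ratio on the circle of radius r at most q < 1.\<close>
  moreover have "\<forall>\<^sub>F x in nhds 0. norm (x / \<phi> x) < min (1 / M) (r / K)"
    using tendstoD[OF tw, of "min (1 / M) (r / K)"] M(1) K(1) r(1) by simp
  moreover have "\<forall>\<^sub>F x :: complex in nhds 0. x \<in> ball 0 r"
    using r(1) by (intro eventually_nhds_in_open) auto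
  ultimately show ?thesis
  proof eventually_elim
    fix x assume \<phi>x: "\<phi> x \<noteq> 0" and wlt: "norm (x / \<phi> x) < min (1 / M) (r / K)" and x: "x \<in> ball 0 r"
    define w where "w = x / \<phi> x"
    define c where "c n = (deriv ^^ n) (\<lambda>t. f t * \<phi> t ^ n) 0 / fact n" for n
    \<comment> \<open>The difference quotient of \<open>\<phi>\<close> at x with its removable
      singularity filled in. Since w \<open>\<phi>\<close>(x) = x, it splits the factor t - x off t
      - w \<open>\<phi>\<close>(t).\<close>
    define \<psi> where "\<psi> t = (if t = x then deriv \<phi> x else (\<phi> t - \<phi> x) / (t - x))" for t
    define q where "q = norm w * K / r"
    have wM: "norm w * M < 1" and q1: "q < 1"
      using wlt M(1) K(1) r(1) by (auto simp: w_def q_def field_simps)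
    have q0: "q \<ge> 0"
      using K(1) r(1) by (simp add: q_def)
    have hol\<psi>: "\<psi> holomorphic_on S"
      unfolding \<psi>_def by (rule pole_lemma_open[OF hol\<phi> S(1)])
    have \<psi>M: "norm (\<psi> t) \<le> M" if "t \<in> cball 0 r" for t
      using lip[OF that, of x] M(2)[OF that] x
      by (auto simp: \<psi>_def norm_divide divide_simps)
    have nz: "1 - w * \<psi> t \<noteq> 0" if "t \<in> cball 0 r" for t
    proof -
      have "norm (w * \<psi> t) \<le> norm w * M"
        using \<psi>M[OF that] by (simp add: norm_mult mult_left_mono)
      then show ?thesis
        using wM by auto
    qed
    have factor: "t - w * \<phi> t = (t - x) * (1 - w * \<psi> t)" for t
    proof (cases "t = x")
      case True
      then show ?thesis using \<phi>x by (simp add: w_def)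
    next
      case False
      then have "(t - x) * \<psi> t = \<phi> t - \<phi> x"
        by (simp add: \<psi>_def)
      moreover have "w * \<phi> x = x"
        using \<phi>x by (simp add: w_def)
      ultimately show ?thesis
        by (simp add: algebra_simps) (metis distrib_left mult.left_commute)
    qed
    have hol: "(\<lambda>t. f t / (1 - w * \<psi> t)) holomorphic_on cball 0 r"
      by (intro holomorphic_intros) (use nz holf hol\<psi> r(2) holomorphic_on_subset in blast)+
    \<comment> \<open>The cofactor of t - x has no zero in the disc, so Cauchy's integral formula at
      x evaluates the integral of f(t) / (t - w \<open>\<phi>\<close>(t)).\<close>
    have "((\<lambda>t. (f t / (1 - w * \<psi> t)) / (t - x)) has_contour_integral
            2 * of_real pi * \<i> * (f x / (1 - w * \<psi> x))) (circlepath 0 r)"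
      using x hol by (intro Cauchy_integral_circlepath holomorphic_on_imp_continuous_on)
        (auto intro: holomorphic_on_subset)
    then have I: "((\<lambda>t. f t / (t - w * \<phi> t)) has_contour_integral
            2 * of_real pi * \<i> * (f x / (1 - w * deriv \<phi> x))) (circlepath 0 r)"
      by (simp add: factor \<psi>_def[of x] mult.commute)
    have C: "((\<lambda>t. f t * \<phi> t ^ n / t ^ Suc n) has_contour_integral
            2 * of_real pi * \<i> * c n) (circlepath 0 r)" for n
    proof -
      have "(\<lambda>t. f t * \<phi> t ^ n) holomorphic_on S"
        by (intro holomorphic_intros holf hol\<phi>)
      moreover from this have "(\<lambda>t. f t * \<phi> t ^ n) holomorphic_on ball 0 r"
        using r(2) by (meson ball_subset_cball holomorphic_on_subset order_trans)
      ultimately have "((\<lambda>t. f t * \<phi> t ^ n / (t - 0) ^ Suc n) has_contour_integral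
          2 * pi * \<i> / fact n * (deriv ^^ n) (\<lambda>t. f t * \<phi> t ^ n) 0) (circlepath 0 r)"
        using r(1) by (intro Cauchy_has_contour_integral_higher_derivative_circlepath cont) auto
      then show ?thesis
        by (simp add: c_def mult.assoc)
    qed
    define P where "P N = (\<Sum>n<N. c n * w ^ n)" for N
    define L where "L = f x / (1 - w * deriv \<phi> x)"
    \<comment> \<open>A pointwise bound on the geometric tail along the circle, times the
      circumference.\<close>
    have est: "norm (2 * of_real pi * \<i> * (L - P N)) \<le> A * q ^ N / (r * (1 - q)) * (2 * pi * r)" for N
    proof (rule has_contour_integral_bound_circlepath[where z = 0 and r = r])
      have "((\<lambda>t. f t / (t - w * \<phi> t) - (\<Sum>n<N. w ^ n * (f t * \<phi> t ^ n / t ^ Suc n)))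
          has_contour_integral (2 * of_real pi * \<i> * L - (\<Sum>n<N. w ^ n * (2 * of_real pi * \<i> * c n))))
          (circlepath 0 r)"
        using I unfolding L_def
        by (intro has_contour_integral_diff has_contour_integral_sum has_contour_integral_lmul C) auto
      then show "((\<lambda>t. f t / (t - w * \<phi> t) - (\<Sum>n<N. w ^ n * (f t * \<phi> t ^ n / t ^ Suc n)))
          has_contour_integral (2 * of_real pi * \<i> * (L - P N))) (circlepath 0 r)"
        by (simp add: P_def right_diff_distrib sum_distrib_left mult_ac)
      show "0 \<le> A * q ^ N / (r * (1 - q))"
        using A(1) q0 q1 r(1) by simp
      fix t :: complex assume t: "norm (t - 0) = r"
      then have t0: "t \<noteq> 0" and tc: "t \<in> cball 0 r"
        using r(1) by auto
      define s where "s = w * \<phi> t / t"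
      have "norm (w * \<phi> t) \<le> norm w * K"
        using K(2)[OF tc] by (simp add: norm_mult mult_left_mono)
      then have sq: "norm s \<le> q"
        using t r(1) by (simp add: s_def q_def norm_divide divide_right_mono)
      have s1: "s \<noteq> 1"
        using sq q1 by auto
      \<comment> \<open>On the circle t - w \<open>\<phi>\<close>(t) = t (1 - s), so the difference
        of the integrands is f(t) / t times the tail s^N / (1 - s).\<close>
      have "(\<Sum>n<N. w ^ n * (f t * \<phi> t ^ n / t ^ Suc n)) = f t / t * (\<Sum>n<N. s ^ n)"
        by (simp add: s_def sum_distrib_left power_mult_distrib power_divide mult_ac)
      also have "(\<Sum>n<N. s ^ n) = (1 - s ^ N) / (1 - s)"
        using s1 by (simp add: sum_gp_strict)
      finally have "f t / (t - w * \<phi> t) - (\<Sum>n<N. w ^ n * (f t * \<phi> t ^ n / t ^ Suc n))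
          = f t / (t * (1 - s)) - f t / t * ((1 - s ^ N) / (1 - s))"
        using t0 by (simp add: s_def right_diff_distrib)
      also have "\<dots> = f t * s ^ N / (t * (1 - s))"
        by (simp add: diff_divide_distrib right_diff_distrib[of "f t"])
      also have "norm \<dots> = norm (f t) * norm s ^ N / (r * norm (1 - s))"
        using t by (simp add: norm_mult norm_divide norm_power)
      also have "\<dots> \<le> A * q ^ N / (r * (1 - q))"
      proof (rule frac_le)
        show "norm (f t) * norm s ^ N \<le> A * q ^ N"
          using A sq tc by (intro mult_mono power_mono) auto
        have "1 - q \<le> norm (1 - s)"
          using sq norm_triangle_ineq2[of 1 s] by simp
        then show "r * (1 - q) \<le> r * norm (1 - s)"
          using r(1) by simp
      qed (use A q0 q1 r in auto)
      finally show "norm (f t / (t - w * \<phi> t) - (\<Sum>n<N. w ^ n * (f t * \<phi> t ^ n / t ^ Suc n)))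
        \<le> A * q ^ N / (r * (1 - q))" .
    qed (use r in simp)
    have "(\<lambda>N. A * q ^ N / (r * (1 - q)) * (2 * pi * r)) \<longlonglongrightarrow> A * 0 / (r * (1 - q)) * (2 * pi * r)"
      using q0 q1 r(1) by (intro tendsto_intros LIMSEQ_power_zero) auto
    then have "(\<lambda>N. 2 * of_real pi * \<i> * (L - P N)) \<longlonglongrightarrow> 0"
      by (intro Lim_null_comparison[OF always_eventually[OF allI[OF est]]]) simp
    \<comment> \<open>Dividing the constant 2 pi i back out turns the expression under the limit
      into P N.\<close>
    then have "(\<lambda>N. L - (2 * of_real pi * \<i> * (L - P N)) / (2 * of_real pi * \<i>)) \<longlonglongrightarrow> L - 0 / (2 * of_real pi * \<i>)"
      by (intro tendsto_intros) auto
    then have "P \<longlonglongrightarrow> L"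
      by simp
    then show "(\<lambda>n. (deriv ^^ n) (\<lambda>t. f t * \<phi> t ^ n) 0 / fact n * (x / \<phi> x) ^ n)
        sums (f x / (1 - x / \<phi> x * deriv \<phi> x))"
      by (simp add: sums_def P_def[abs_def] L_def c_def w_def)
  qed
qed

section \<open>The coefficients as Taylor coefficients\<close>

lemma exp_square_has_fps_expansion:
  fixes c :: complex
  shows "(\<lambda>t. exp (c * t\<^sup>2)) has_fps_expansion
    Abs_fps (\<lambda>i. if even i then c ^ (i div 2) / fact (i div 2) else 0)"
proof (intro has_fps_expansionI always_eventually allI)
  fix t :: complex
  have "(\<lambda>k. (c * t\<^sup>2) ^ k /\<^sub>R fact k) sums exp (c * t\<^sup>2)"
    by (rule exp_converges)
  then have "(\<lambda>k. (\<lambda>i. (if even i then c ^ (i div 2) / fact (i div 2) else 0) * t ^ i) (2 * k))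
      sums exp (c * t\<^sup>2)"
    by (simp add: power_mult_distrib scaleR_conv_of_real field_simps flip: power_mult)
  then show "(\<lambda>i. fps_nth (Abs_fps (\<lambda>i. if even i then c ^ (i div 2) / fact (i div 2) else 0)) i * t ^ i)
      sums exp (c * t\<^sup>2)"
    by (subst (asm) sums_mono_reindex) (auto simp: strict_mono_def elim!: evenE)
qed

text \<open>The duplication formula (2u)_{2k} = 4^k (u)_k (u + 1/2)_k, at u = -n/2 and u = 1/2,
  turns the quotient into (-n)_{2k} / (2k)!; the even index makes the sign positive.\<close>

lemma pochhammer_quotient_eq_choose:
  "pochhammer (1/2 - of_nat n / 2) k * pochhammer (- (of_nat n / 2)) k /
     (pochhammer (1/2) k * pochhammer 1 k) = (of_nat (n choose (2 * k)) :: complex)"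
proof -
  let ?p = "pochhammer (1/2 - of_nat n / 2) k * pochhammer (- (of_nat n / 2)) k :: complex"
  have num: "pochhammer (- of_nat n :: complex) (2 * k) = 2 ^ (2 * k) * ?p"
    using pochhammer_double[of "- (of_nat n / 2) :: complex" k] by (simp add: mult_ac)
  have den: "fact (2 * k) = 2 ^ (2 * k) * (pochhammer (1/2) k * pochhammer 1 k :: complex)"
    using pochhammer_double[of "1/2 :: complex" k] by (simp add: pochhammer_fact)
  have "of_nat (n choose (2 * k)) = pochhammer (- of_nat n :: complex) (2 * k) / fact (2 * k)"
    by (simp add: binomial_gbinomial gbinomial_pochhammer)
  then show ?thesis
    unfolding num den by simp
qed

lemma hyp2F2_eq_higher_deriv:
  "hyp2F2 (1/2 - of_nat n / 2) (- (of_nat n / 2)) (1/2) 1 z =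
     (deriv ^^ n) (\<lambda>t. exp (z * t\<^sup>2) * (1 + t) ^ n) 0 / fact n"
proof -
  define E where "E = Abs_fps (\<lambda>i. if even i then z ^ (i div 2) / fact (i div 2) else 0)"
  define g where "g i = fps_nth E i * of_nat (n choose i)" for i
  \<comment> \<open>Terms with i > n vanish through the binomial coefficient and odd terms through
    E, so the sum over i = 2k is this finite sum.\<close>
  have "g sums (\<Sum>i\<in>{0..n}. g i)"
    by (rule sums_finite) (auto simp: g_def)
  then have "(\<lambda>k. g (2 * k)) sums (\<Sum>i\<in>{0..n}. g i)"
    by (subst sums_mono_reindex) (auto simp: strict_mono_def g_def E_def elim!: evenE)
  moreover have "pochhammer (1/2 - of_nat n / 2) k * pochhammer (- (of_nat n / 2)) k /
      (pochhammer (1/2) k * pochhammer 1 k * fact k) * z ^ k = g (2 * k)" for k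
    using pochhammer_quotient_eq_choose[of n k, symmetric]
    by (simp add: g_def E_def mult_ac)
  ultimately have "hyp2F2 (1/2 - of_nat n / 2) (- (of_nat n / 2)) (1/2) 1 z = (\<Sum>i\<in>{0..n}. g i)"
    by (simp add: hyp2F2_def sums_iff)
  \<comment> \<open>By symmetry \<open>n choose i\<close> is the coefficient of index n - i of (1 +
    X)^n, which exposes a Cauchy product.\<close>
  also have "\<dots> = (\<Sum>i=0..n. fps_nth E i * fps_nth ((1 + fps_X) ^ n) (n - i))"
    by (intro sum.cong refl)
      (auto simp: g_def fps_binomial_of_nat[symmetric] simp flip: binomial_gbinomial binomial_symmetric)
  also have "\<dots> = fps_nth (E * (1 + fps_X) ^ n) n"
    by (simp add: fps_mult_nth)
  also have "\<dots> = (deriv ^^ n) (\<lambda>t. exp (z * t\<^sup>2) * (1 + t) ^ n) 0 / fact n"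
    unfolding E_def
    by (intro fps_nth_fps_expansion fps_expansion_intros exp_square_has_fps_expansion)
  finally show ?thesis .
qed

text \<open>Because a + bn is affine in n, the exponential splits into a fixed factor and an n-th
  power, the shape that Lagrange inversion requires.\<close>

lemma gf_coeff_eq_higher_deriv:
  "gf_coeff a b n =
     (deriv ^^ n) (\<lambda>t. exp (a * t\<^sup>2) * ((1 + t) * exp (b * t\<^sup>2)) ^ n) 0 / fact n"
proof -
  have "exp ((a + b * of_nat n) * t\<^sup>2) * (1 + t) ^ n =
      exp (a * t\<^sup>2) * ((1 + t) * exp (b * t\<^sup>2)) ^ n" for t
    unfolding power_mult_distrib exp_of_nat_mult[symmetric]
    by (simp add: algebra_simps exp_add[symmetric])
  then show ?thesis
    by (simp add: gf_coeff_def hyp2F2_eq_higher_deriv)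
qed

section \<open>The identity near the origin\<close>

lemma gf_coeff_sums_near_0:
  "\<forall>\<^sub>F x in nhds 0. (\<lambda>n. gf_coeff a b n * gf_arg b x ^ n)
     sums (- ((x + 1) * exp (a * x\<^sup>2) / (2 * b * x ^ 3 + 2 * b * x\<^sup>2 - 1)))"
proof -
  define \<phi> where "\<phi> t = (1 + t) * exp (b * t\<^sup>2)" for t
  have "\<forall>\<^sub>F x in nhds 0.
    (\<lambda>n. (deriv ^^ n) (\<lambda>t. exp (a * t\<^sup>2) * \<phi> t ^ n) 0 / fact n * (x / \<phi> x) ^ n)
      sums (exp (a * x\<^sup>2) / (1 - x / \<phi> x * deriv \<phi> x))"
    by (rule lagrange_inversion_sums[of UNIV]) (auto simp: \<phi>_def intro!: holomorphic_intros)
  \<comment> \<open>\<open>\<phi>\<close> vanishes at -1, so that point is excluded before dividing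
    by 1 + x.\<close>
  moreover have "\<forall>\<^sub>F x :: complex in nhds 0. x \<in> - {-1}"
    by (intro eventually_nhds_in_open) auto
  ultimately show ?thesis
  proof eventually_elim
    case (elim x)
    have x: "1 + x \<noteq> 0"
      using elim(2) by (simp add: add_eq_0_iff)
    have arg: "x / \<phi> x = gf_arg b x"
      by (simp add: \<phi>_def gf_arg_def exp_minus field_simps)
    have "(\<phi> has_field_derivative exp (b * x\<^sup>2) * (1 + 2 * b * x * (1 + x))) (at x)"
      unfolding \<phi>_def by (auto intro!: derivative_eq_intros simp: algebra_simps)
    then have "x / \<phi> x * deriv \<phi> x = x * (1 + 2 * b * x * (1 + x)) / (1 + x)"
      using x by (simp add: DERIV_imp_deriv \<phi>_def)
    then have "1 - x / \<phi> x * deriv \<phi> x = - ((2 * b * x ^ 3 + 2 * b * x\<^sup>2 - 1) / (1 + x))"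
      using x by (simp add: field_simps power2_eq_square power3_eq_cube)
    \<comment> \<open>Where the cubic is zero, both sides are 0 by the convention for
      division.\<close>
    then have "exp (a * x\<^sup>2) / (1 - x / \<phi> x * deriv \<phi> x)
        = - ((x + 1) * exp (a * x\<^sup>2) / (2 * b * x ^ 3 + 2 * b * x\<^sup>2 - 1))"
      by (simp add: add.commute mult.commute)
    with elim(1) show ?case
      by (simp add: arg gf_coeff_eq_higher_deriv[of a b, folded \<phi>_def])
  qed
qed

text \<open>A power series converging at a nonzero point has positive radius, and
  \<open>gf_arg b x\<close> is such a point for small nonzero x. This places 0 in the
  domain.\<close>

lemma conv_radius_gf_coeff_pos: "conv_radius (gf_coeff a b) > 0"
proof -
  have "\<forall>\<^sub>F x in at 0. summable (\<lambda>n. gf_coeff a b n * gf_arg b x ^ n)"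
    using gf_coeff_sums_near_0[of a b] unfolding eventually_nhds_conv_at
    by (auto elim!: eventually_mono simp: sums_iff)
  moreover have "\<forall>\<^sub>F x :: complex in at 0. x \<in> - {-1} - {0}"
    by (intro eventually_at_in_open) auto
  ultimately have "\<forall>\<^sub>F x in at 0. summable (\<lambda>n. gf_coeff a b n * gf_arg b x ^ n) \<and> gf_arg b x \<noteq> 0"
    by eventually_elim (auto simp: gf_arg_def add_eq_0_iff2)
  then obtain x where "summable (\<lambda>n. gf_coeff a b n * gf_arg b x ^ n)" "gf_arg b x \<noteq> 0"
    using eventually_happens'[of "at (0::complex)"] by auto
  then show ?thesis
    using conv_radius_geI[of "gf_coeff a b" "gf_arg b x"]
    by (meson ereal_less(2) less_le_trans zero_less_norm_iff)
qed

section \<open>Analytic continuation over the component of 0\<close>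

theorem proposition3p33:
  fixes a b :: complex
  shows "open (gf_domain a b) \<and> 0 \<in> gf_domain a b \<and>
    (\<forall>x \<in> gf_domain a b.
       2 * b * x ^ 3 + 2 * b * x\<^sup>2 - 1 \<noteq> 0 \<and>
       (\<lambda>n. (x * exp (- b * x\<^sup>2) / (x + 1)) ^ n *
            hyp2F2 (1/2 - of_nat n / 2) (- (of_nat n / 2)) (1/2) 1 (a + b * of_nat n))
         sums (- ((x + 1) * exp (a * x\<^sup>2) / (2 * b * x ^ 3 + 2 * b * x\<^sup>2 - 1))))"
proof -
  define R where "R = conv_radius (gf_coeff a b)"
  define D where "D = gf_domain a b"
  define W where "W = {x. x \<noteq> -1 \<and> ereal (norm (gf_arg b x)) < R}"
  define F where "F = Abs_fps (gf_coeff a b)"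
  define d where "d x = 2 * b * x ^ 3 + 2 * b * x\<^sup>2 - 1" for x
  have D_eq: "D = connected_component_set W 0"
    by (simp add: D_def gf_domain_def W_def R_def)
  have DW: "D \<subseteq> W"
    unfolding D_eq by (rule connected_component_subset)
  have hol_arg: "gf_arg b holomorphic_on - {-1}"
    unfolding gf_arg_def by (intro holomorphic_intros) (auto simp: add_eq_0_iff2)
  have "W = (- {-1}) \<inter> gf_arg b -` eball 0 R"
    by (auto simp: W_def)
  then have "open W"
    using continuous_open_preimage[OF holomorphic_on_imp_continuous_on[OF hol_arg], of "eball 0 R"]
    by auto
  then have openD: "open D"
    unfolding D_eq by (rule open_connected_component)
  have "0 \<in> W"
    using conv_radius_gf_coeff_pos by (simp add: W_def gf_arg_def R_def flip: zero_ereal_def)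
  then have D0: "0 \<in> D"
    by (simp add: D_eq)
  have sums_F: "(\<lambda>n. gf_coeff a b n * gf_arg b x ^ n) sums eval_fps F (gf_arg b x)" if "x \<in> D" for x
  proof -
    have "summable (\<lambda>n. gf_coeff a b n * gf_arg b x ^ n)"
      using that DW by (intro summable_in_conv_radius) (auto simp: W_def R_def)
    then show ?thesis
      by (simp add: eval_fps_def F_def summable_sums)
  qed
  have "(eval_fps F \<circ> gf_arg b) holomorphic_on D"
  proof (rule holomorphic_on_compose_gen)
    show "gf_arg b holomorphic_on D"
      using hol_arg DW by (rule_tac holomorphic_on_subset) (auto simp: W_def)
    show "eval_fps F holomorphic_on eball 0 R"
      by (intro holomorphic_on_eval_fps) (simp add: R_def F_def fps_conv_radius_def fps_nth_Abs_fps eta_contract_eq)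
    show "gf_arg b ` D \<subseteq> eball 0 R"
      using DW by (auto simp: W_def)
  qed
  then have hol_lhs: "(\<lambda>x. eval_fps F (gf_arg b x) * d x) holomorphic_on D"
    unfolding d_def comp_def by (intro holomorphic_intros)
  \<comment> \<open>Since d(0) = -1, the neighbourhood U can be chosen free of zeros of d, so that
    multiplying the local identity by d really cancels the division.\<close>
  have "\<forall>\<^sub>F x in nhds 0. d x \<noteq> 0"
  proof (rule tendsto_imp_eventually_ne)
    show "(d \<longlongrightarrow> 2 * b * 0 ^ 3 + 2 * b * 0\<^sup>2 - 1) (nhds 0)"
      unfolding d_def by (intro tendsto_intros filterlim_ident)
  qed simp
  with gf_coeff_sums_near_0[of a b, folded d_def]
  have "\<forall>\<^sub>F x in nhds 0. (\<lambda>n. gf_coeff a b n * gf_arg b x ^ n)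
      sums (- ((x + 1) * exp (a * x\<^sup>2) / d x)) \<and> d x \<noteq> 0"
    by eventually_elim simp
  then obtain U where U: "open U" "0 \<in> U"
      "\<And>x. x \<in> U \<Longrightarrow> (\<lambda>n. gf_coeff a b n * gf_arg b x ^ n) sums (- ((x + 1) * exp (a * x\<^sup>2) / d x))"
      "\<And>x. x \<in> U \<Longrightarrow> d x \<noteq> 0"
    unfolding eventually_nhds by blast
  \<comment> \<open>The identity theorem applies because U \<inter> D is open and contains 0, and D
    is connected.\<close>
  have main: "eval_fps F (gf_arg b x) * d x = - ((x + 1) * exp (a * x\<^sup>2))" if "x \<in> D" for x
  proof (rule analytic_continuation_open[of "U \<inter> D" D
        "\<lambda>x. eval_fps F (gf_arg b x) * d x" "\<lambda>x. - ((x + 1) * exp (a * x\<^sup>2))"])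
    show "connected D"
      by (simp add: D_eq)
    show "eval_fps F (gf_arg b z) * d z = - ((z + 1) * exp (a * z\<^sup>2))" if "z \<in> U \<inter> D" for z
      using sums_unique2[OF sums_F U(3)] U(4) that by simp
    show "(\<lambda>x. - ((x + 1) * exp (a * x\<^sup>2))) holomorphic_on D"
      by (intro holomorphic_intros)
  qed (use U D0 openD that hol_lhs in auto)
  have "d x \<noteq> 0 \<and> (\<lambda>n. gf_coeff a b n * gf_arg b x ^ n) sums (- ((x + 1) * exp (a * x\<^sup>2) / d x))"
    if "x \<in> D" for x
  proof
    have "x + 1 \<noteq> 0"
      using that DW by (auto simp: W_def add_eq_0_iff2)
    then show d0: "d x \<noteq> 0"
      using main[OF that] by auto
    then have "eval_fps F (gf_arg b x) = - ((x + 1) * exp (a * x\<^sup>2) / d x)"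
      using main[OF that] by (simp add: field_simps)
    with sums_F[OF that] show "(\<lambda>n. gf_coeff a b n * gf_arg b x ^ n) sums (- ((x + 1) * exp (a * x\<^sup>2) / d x))"
      by simp
  qed
  then show ?thesis
    using openD D0 by (simp add: D_def d_def gf_coeff_def gf_arg_def mult.commute[of "_ ^ _"])
qed

end
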